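(* Let $p\ge q\ge 2$ be integers. The separation problem for shifted column inequalities can be solved in linear time $O(pq)$: there is an algorithm that, given $x^\star\in\mathbb{Q}^{\mathcal{I}_{p,q}}$, decides in time $O(pq)$ whether $x^\star$ satisfies all shifted column inequalities and, if not, outputs a shifted column inequality violated by $x^\star$.
   Context: Notation: $[n]=\{1,\dots,n\}$; $\mathcal{I}_{p,q}=\{(i,j)\in[p]\times[q] : i\ge j\}$; $x(T)=\sum_{(i,j)\in T}x_{ij}$ for $T\subseteq\mathcal{I}_{p,q}$. Diagonal coordinates: $\langle\eta,j\rangle := (j+\eta-1,j)$ for $j\in[q]$, $1\le\eta\le p-j+1$; $\mathrm{col}\langle\eta,j\rangle=\{\langle1,j\rangle,\dots,\langle\eta,j\rangle\}$. A shifted column is a set $S=\{\langle1,c_1\rangle,\langle2,c_2\rangle,\dots,\langle\eta,c_\eta\rangle\}\subset\mathcal{I}_{p,q}$ with $\eta\ge1$ and $c_1\le c_2\le\dots\le c_\eta$; it is called a shifting of each of the columns $\mathrm{col}\langle\eta,c_\eta\rangle,\mathrm{col}\langle\eta,c_\eta+1\rangle,\dots,\mathrm{col}\langle\eta,q\rangle$. For $(i,j)=\langle\eta,j\rangle\in\mathcal{I}_{p,q}$ with $j\ge2$, the bar $B=\{(i,j),(i,j+1),\dots,(i,\min\{i,q\})\}$, and a shifting $S$ of $\mathrm{col}\langle\eta,j-1\rangle$, the inequality $x(B)-x(S)\le0$ is called a shifted column inequality. Running times are counted in the unit-cost (arithmetic operation) model. *)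

theory Defs
  imports Complex_Main
begin

section \<open>Shifted column inequalities\<close>

definition index_set :: "nat \<Rightarrow> nat \<Rightarrow> (nat \<times> nat) set" where
  "index_set p q = {(i, j). 1 \<le> i \<and> i \<le> p \<and> 1 \<le> j \<and> j \<le> q \<and> j \<le> i}"

text \<open>The position with diagonal coordinates \<open>\<eta>, j\<close>, meant for \<open>\<eta> \<ge> 1\<close> and \<open>j \<ge> 1\<close>.\<close>

definition diag :: "nat \<Rightarrow> nat \<Rightarrow> nat \<times> nat" where
  "diag \<eta> j = (j + \<eta> - 1, j)"

definition col :: "nat \<Rightarrow> nat \<Rightarrow> (nat \<times> nat) set" where
  "col \<eta> j = (\<lambda>k. diag k j) ` {1..\<eta>}"

text \<open>\<open>shifted_column p q \<eta> c S\<close>: the set \<open>S\<close> is the shifted column of length \<open>\<eta>\<close> with column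
  indices \<open>c 1 \<le> \<dots> \<le> c \<eta>\<close>; the values of \<open>c\<close> outside \<open>{1..\<eta>}\<close> are irrelevant.\<close>

definition shifted_column ::
  "nat \<Rightarrow> nat \<Rightarrow> nat \<Rightarrow> (nat \<Rightarrow> nat) \<Rightarrow> (nat \<times> nat) set \<Rightarrow> bool" where
  "shifted_column p q \<eta> c S \<longleftrightarrow>
     1 \<le> \<eta> \<and> mono_on {1..\<eta>} c \<and> S = (\<lambda>k. diag k (c k)) ` {1..\<eta>} \<and> S \<subseteq> index_set p q"

definition is_shifting :: "nat \<Rightarrow> nat \<Rightarrow> (nat \<times> nat) set \<Rightarrow> (nat \<times> nat) set \<Rightarrow> bool" where
  "is_shifting p q S T \<longleftrightarrow>
     (\<exists>\<eta> c l. shifted_column p q \<eta> c S \<and> c \<eta> \<le> l \<and> l \<le> q \<and>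
              diag \<eta> l \<in> index_set p q \<and> T = col \<eta> l)"

definition bar :: "nat \<Rightarrow> nat \<Rightarrow> nat \<Rightarrow> (nat \<times> nat) set" where
  "bar q i j = {i} \<times> {j..min i q}"

text \<open>A shifted column inequality \<open>x(B) - x(S) \<le> 0\<close> is represented by the pair \<open>B, S\<close>.\<close>

definition shifted_column_ineq ::
  "nat \<Rightarrow> nat \<Rightarrow> (nat \<times> nat) set \<Rightarrow> (nat \<times> nat) set \<Rightarrow> bool" where
  "shifted_column_ineq p q B S \<longleftrightarrow>
     (\<exists>\<eta> i j. 1 \<le> \<eta> \<and> 2 \<le> j \<and> (i, j) = diag \<eta> j \<and> (i, j) \<in> index_set p q \<and>
              B = bar q i j \<and> is_shifting p q S (col \<eta> (j - 1)))"

definition satisfies :: "(nat \<times> nat \<Rightarrow> rat) \<Rightarrow> (nat \<times> nat) set \<Rightarrow> (nat \<times> nat) set \<Rightarrow> bool" where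
  "satisfies x B S \<longleftrightarrow> sum x B - sum x S \<le> 0"


section \<open>A unit-cost model of computation\<close>

text \<open>
  Algorithms are programs of a small imperative language with two kinds of data, natural numbers
  (for control, addresses and output) and rationals (for the input vector), each held in scalar
  variables and in one-dimensional arrays. Every variable access, constant, arithmetic operation,
  comparison, array access, assignment and output operation costs one unit. No operation converts
  between the two kinds of data: rationals influence the control flow only through comparisons.
  Subtraction of natural numbers is truncated, and division of a rational by \<open>0\<close> yields \<open>0\<close>.
\<close>

type_synonym name = nat

datatype iexp =
    IConst nat
  | IVar name
  | IElem name iexp
  | IAdd iexp iexp
  | ISub iexp iexp
  | IMul iexp iexp

datatype rexp =
    RConst rat
  | RVar name
  | RElem name iexp
  | RAdd rexp rexp
  | RSub rexp rexp
  | RMul rexp rexp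
  | RDiv rexp rexp

datatype test =
    ILess iexp iexp
  | RLess rexp rexp

datatype com =
    Skip
  | ISet name iexp
  | IStore name iexp iexp
  | RSet name rexp
  | RStore name iexp rexp
  | Write iexp
  | Seq com com
  | If test com com
  | While test com

record state =
  ivar :: "name \<Rightarrow> nat"
  iarr :: "name \<Rightarrow> nat \<Rightarrow> nat"
  rvar :: "name \<Rightarrow> rat"
  rarr :: "name \<Rightarrow> nat \<Rightarrow> rat"
  out :: "nat list"

primrec ival :: "iexp \<Rightarrow> state \<Rightarrow> nat" where
  "ival (IConst n) s = n"
| "ival (IVar v) s = ivar s v"
| "ival (IElem a e) s = iarr s a (ival e s)"
| "ival (IAdd e1 e2) s = ival e1 s + ival e2 s"
| "ival (ISub e1 e2) s = ival e1 s - ival e2 s"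
| "ival (IMul e1 e2) s = ival e1 s * ival e2 s"

primrec icost :: "iexp \<Rightarrow> nat" where
  "icost (IConst n) = 1"
| "icost (IVar v) = 1"
| "icost (IElem a e) = 1 + icost e"
| "icost (IAdd e1 e2) = 1 + icost e1 + icost e2"
| "icost (ISub e1 e2) = 1 + icost e1 + icost e2"
| "icost (IMul e1 e2) = 1 + icost e1 + icost e2"

primrec rval :: "rexp \<Rightarrow> state \<Rightarrow> rat" where
  "rval (RConst r) s = r"
| "rval (RVar v) s = rvar s v"
| "rval (RElem a e) s = rarr s a (ival e s)"
| "rval (RAdd e1 e2) s = rval e1 s + rval e2 s"
| "rval (RSub e1 e2) s = rval e1 s - rval e2 s"
| "rval (RMul e1 e2) s = rval e1 s * rval e2 s"
| "rval (RDiv e1 e2) s = rval e1 s / rval e2 s"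

primrec rcost :: "rexp \<Rightarrow> nat" where
  "rcost (RConst r) = 1"
| "rcost (RVar v) = 1"
| "rcost (RElem a e) = 1 + icost e"
| "rcost (RAdd e1 e2) = 1 + rcost e1 + rcost e2"
| "rcost (RSub e1 e2) = 1 + rcost e1 + rcost e2"
| "rcost (RMul e1 e2) = 1 + rcost e1 + rcost e2"
| "rcost (RDiv e1 e2) = 1 + rcost e1 + rcost e2"

primrec tval :: "test \<Rightarrow> state \<Rightarrow> bool" where
  "tval (ILess e1 e2) s \<longleftrightarrow> ival e1 s < ival e2 s"
| "tval (RLess e1 e2) s \<longleftrightarrow> rval e1 s < rval e2 s"

primrec tcost :: "test \<Rightarrow> nat" where
  "tcost (ILess e1 e2) = 1 + icost e1 + icost e2"
| "tcost (RLess e1 e2) = 1 + rcost e1 + rcost e2"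

text \<open>\<open>exec c s t s'\<close>: started in state \<open>s\<close>, program \<open>c\<close> halts in state \<open>s'\<close> after time \<open>t\<close>.\<close>

inductive exec :: "com \<Rightarrow> state \<Rightarrow> nat \<Rightarrow> state \<Rightarrow> bool" where
  Skip: "exec Skip s 1 s"
| ISet: "exec (ISet v e) s (1 + icost e) (s\<lparr>ivar := (ivar s)(v := ival e s)\<rparr>)"
| IStore: "exec (IStore a e1 e2) s (1 + icost e1 + icost e2)
    (s\<lparr>iarr := (iarr s)(a := (iarr s a)(ival e1 s := ival e2 s))\<rparr>)"
| RSet: "exec (RSet v e) s (1 + rcost e) (s\<lparr>rvar := (rvar s)(v := rval e s)\<rparr>)"
| RStore: "exec (RStore a e1 e2) s (1 + icost e1 + rcost e2)
    (s\<lparr>rarr := (rarr s)(a := (rarr s a)(ival e1 s := rval e2 s))\<rparr>)"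
| Write: "exec (Write e) s (1 + icost e) (s\<lparr>out := out s @ [ival e s]\<rparr>)"
| Seq: "exec c1 s t1 s1 \<Longrightarrow> exec c2 s1 t2 s2 \<Longrightarrow> exec (Seq c1 c2) s (t1 + t2) s2"
| IfTrue: "tval b s \<Longrightarrow> exec c1 s t s1 \<Longrightarrow> exec (If b c1 c2) s (tcost b + t) s1"
| IfFalse: "\<not> tval b s \<Longrightarrow> exec c2 s t s1 \<Longrightarrow> exec (If b c1 c2) s (tcost b + t) s1"
| WhileFalse: "\<not> tval b s \<Longrightarrow> exec (While b c) s (tcost b) s"
| WhileTrue: "tval b s \<Longrightarrow> exec c s t1 s1 \<Longrightarrow> exec (While b c) s1 t2 s2 \<Longrightarrow>
    exec (While b c) s (tcost b + t1 + t2) s2"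

inductive_cases SkipE: "exec Skip s t s'"
inductive_cases ISetE: "exec (ISet v e) s t s'"
inductive_cases IStoreE: "exec (IStore a e1 e2) s t s'"
inductive_cases RSetE: "exec (RSet v e) s t s'"
inductive_cases RStoreE: "exec (RStore a e1 e2) s t s'"
inductive_cases WriteE: "exec (Write e) s t s'"
inductive_cases SeqE: "exec (Seq c1 c2) s t s'"
inductive_cases IfE: "exec (If b c1 c2) s t s'"
inductive_cases WhileE: "exec (While b c) s t s'"

lemma exec_deterministic:
  "exec c s t s' \<Longrightarrow> exec c s u s'' \<Longrightarrow> u = t \<and> s'' = s'"
proof (induction arbitrary: u s'' rule: exec.induct)
  case (Seq c1 s t1 s1 c2 t2 s2)
  from Seq.prems show ?case by (rule SeqE) (use Seq.IH in blast)
next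
  case (IfTrue b s c1 t s1 c2)
  from IfTrue.prems show ?case by (rule IfE) (use IfTrue in blast)+
next
  case (IfFalse b s c2 t s1 c1)
  from IfFalse.prems show ?case by (rule IfE) (use IfFalse in blast)+
next
  case (WhileFalse b s c)
  from WhileFalse.prems show ?case by (rule WhileE) (use WhileFalse in blast)+
next
  case (WhileTrue b s c t1 s1 t2 s2)
  from WhileTrue.prems show ?case by (rule WhileE) (use WhileTrue in blast)+
qed (auto elim: SkipE ISetE IStoreE RSetE RStoreE WriteE)


section \<open>The separation problem\<close>

text \<open>
  On input, variables \<open>0\<close> and \<open>1\<close> hold \<open>p\<close> and \<open>q\<close>, and rational array \<open>0\<close> holds the vector \<open>x\<close> as
  a \<open>p \<times> q\<close> matrix in row-major order: \<open>x (i, j)\<close> is at address \<open>(i - 1) * q + (j - 1)\<close>. All other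
  data are \<open>0\<close>, in particular the addresses that do not belong to a position in the index set, so
  that the values of \<open>x\<close> outside the index set are not visible to the program.
\<close>

definition input_array :: "nat \<Rightarrow> nat \<Rightarrow> (nat \<times> nat \<Rightarrow> rat) \<Rightarrow> nat \<Rightarrow> rat" where
  "input_array p q x k =
     (let i = k div q + 1; j = k mod q + 1 in if (i, j) \<in> index_set p q then x (i, j) else 0)"

definition initial_state :: "nat \<Rightarrow> nat \<Rightarrow> (nat \<times> nat \<Rightarrow> rat) \<Rightarrow> state" where
  "initial_state p q x =
     \<lparr>ivar = (\<lambda>_. 0)(0 := p, 1 := q), iarr = (\<lambda>_ _. 0),
      rvar = (\<lambda>_. 0), rarr = (\<lambda>_ _. 0)(0 := input_array p q x), out = []\<rparr>"

definition encode_positions :: "(nat \<times> nat) list \<Rightarrow> nat list" where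
  "encode_positions ps = length ps # concat (map (\<lambda>(i, j). [i, j]) ps)"

text \<open>The answer \<open>0\<close> means that all inequalities hold. Otherwise the answer is \<open>1\<close> followed by
  repetition-free lists, in any order, of the positions in \<open>B\<close> and in \<open>S\<close>.\<close>

definition correct_answer :: "nat \<Rightarrow> nat \<Rightarrow> (nat \<times> nat \<Rightarrow> rat) \<Rightarrow> nat list \<Rightarrow> bool" where
  "correct_answer p q x ans \<longleftrightarrow>
     (if \<forall>B S. shifted_column_ineq p q B S \<longrightarrow> satisfies x B S
      then ans = [0]
      else \<exists>bs ss. ans = 1 # encode_positions bs @ encode_positions ss \<and>
             distinct bs \<and> distinct ss \<and>
             shifted_column_ineq p q (set bs) (set ss) \<and> \<not> satisfies x (set bs) (set ss))"

end

theory Submission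
  imports Defs
begin

text \<open>
  Let \<open>min_shift i j\<close> be the least value of \<open>x(S)\<close> over the shiftings \<open>S\<close> of the column that ends at
  \<open>(i, j)\<close>. An optimal \<open>S\<close> either contains \<open>(i, j)\<close>, and the rest is a shifting of the column ending
  at \<open>(i - 1, j)\<close>, or it is a shifting of the column ending at \<open>(i - 1, j - 1)\<close>, which has the
  same length. So all values are computed row by row in constant time each. Some inequality with the
  bar starting at \<open>(i, j)\<close> is violated iff \<open>min_shift (i - 1) (j - 1)\<close> is less than the bar
  sum, and retracing the choices of the minimum yields a violating \<open>S\<close>.
\<close>

section \<open>Minimal shiftings\<close>

locale separation =
  fixes p q :: nat and x :: "nat \<times> nat \<Rightarrow> rat"
  assumes q_ge_2: "2 \<le> q" and q_le_p: "q \<le> p"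
begin

text \<open>Extending \<open>x\<close> by \<open>0\<close> above the diagonal makes \<open>min_shift\<close> and all partial row sums vanish
  there, so the program can scan full rows without treating the diagonal specially.\<close>

definition entry :: "nat \<Rightarrow> nat \<Rightarrow> rat" where
  "entry i j = (if (i, j) \<in> index_set p q then x (i, j) else 0)"

fun min_shift :: "nat \<Rightarrow> nat \<Rightarrow> rat" where
  "min_shift 0 j = 0"
| "min_shift (Suc i) j =
     (if 1 < j \<and> min_shift i (j - 1) < min_shift i j + entry (Suc i) j
      then min_shift i (j - 1) else min_shift i j + entry (Suc i) j)"

text \<open>The list ends once the column ending at the current position has length 0. Otherwise the
  comparison is literally that of \<open>min_shift\<close>, so the collected entries add up to the
  minimum.\<close>

fun trace :: "nat \<Rightarrow> nat \<Rightarrow> (nat \<times> nat) list" where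
  "trace 0 j = []"
| "trace (Suc i) j =
     (if Suc i < j then []
      else if 1 < j \<and> min_shift i (j - 1) < min_shift i j + entry (Suc i) j
      then trace i (j - 1) else (Suc i, j) # trace i j)"

text \<open>Entries above the diagonal are 0, so the sum may run up to \<open>q\<close> instead of
  \<open>min i q\<close>. For the same reason \<open>j \<le> i\<close> need not be demanded: above
  the diagonal both sides vanish and the strict comparison fails.\<close>

definition violated :: "nat \<Rightarrow> nat \<Rightarrow> bool" where
  "violated i j \<longleftrightarrow> 1 \<le> i \<and> i \<le> p \<and> 2 \<le> j \<and> j \<le> q \<and>
     min_shift (i - 1) (j - 1) < (\<Sum>k = j..q. entry i k)"

lemma entry_eq_0: "i < j \<Longrightarrow> entry i j = 0"
  by (simp add: entry_def index_set_def)

lemma min_shift_above_diagonal: "i < j \<Longrightarrow> min_shift i j = 0"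
  by (induction i arbitrary: j) (auto simp: entry_eq_0)

lemma trace_above_diagonal: "i < j \<Longrightarrow> trace i j = []"
  by (cases i) auto

lemma violated_below_diagonal:
  assumes "violated i j" shows "j \<le> i"
proof (rule ccontr)
  assume "\<not> j \<le> i"
  moreover from this have "i - 1 < j - 1"
    using assms by (auto simp: violated_def)
  ultimately show False
    using assms min_shift_above_diagonal[of "i - 1" "j - 1"]
    by (simp add: violated_def entry_eq_0)
qed

lemma min_shift_le:
  assumes "mono_on {1..\<eta>} c" "\<And>k. k \<in> {1..\<eta>} \<Longrightarrow> c k \<le> j" "1 \<le> j" "Suc i = j + \<eta>"
    "\<And>k. k \<in> {1..\<eta>} \<Longrightarrow> 1 \<le> c k"
  shows "min_shift i j \<le> (\<Sum>k = 1..\<eta>. entry (c k + k - 1) (c k))"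
  using assms
proof (induction i arbitrary: j \<eta>)
  case 0
  then show ?case by simp
next
  case (Suc i)
  show ?case
  proof (cases \<eta>)
    case 0
    with Suc.prems show ?thesis by (simp add: min_shift_above_diagonal del: min_shift.simps)
  next
    case (Suc h)
    have c_le: "c k \<le> c \<eta>" if "k \<in> {1..\<eta>}" for k
      using Suc.prems(1) that Suc by (auto simp: monotone_on_def)
    show ?thesis
    proof (cases "c \<eta> = j")
      case True
      have "min_shift i j \<le> (\<Sum>k = 1..h. entry (c k + k - 1) (c k))"
        using Suc.prems Suc by (intro Suc.IH) (auto simp: monotone_on_def)
      moreover have "entry (c \<eta> + \<eta> - 1) (c \<eta>) = entry (Suc i) j"
        using True Suc.prems(4) Suc by (metis diff_Suc_1)
      ultimately show ?thesis using Suc by auto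
    next
      case False
      then have less: "c \<eta> < j" and "1 \<le> c \<eta>"
        using Suc.prems(2)[of \<eta>] Suc.prems(5)[of \<eta>] Suc by auto
      then have "1 < j" by simp
      have "min_shift i (j - 1) \<le> (\<Sum>k = 1..\<eta>. entry (c k + k - 1) (c k))"
      proof (rule Suc.IH)
        show "c k \<le> j - 1" if "k \<in> {1..\<eta>}" for k
          using c_le[OF that] less by simp
      qed (use Suc.prems \<open>1 < j\<close> in auto)
      with \<open>1 < j\<close> show ?thesis by auto
    qed
  qed
qed

text \<open>The lower bound is attained: a diagonal move keeps \<open>c\<close>, a recorded position
  appends \<open>j\<close> as new last index. Length and distinctness are carried along for the
  output format.\<close>

lemma trace_spec:
  assumes "1 \<le> j" "Suc i = j + \<eta>"
  shows "\<exists>c. mono_on {1..\<eta>} c \<and> (\<forall>k \<in> {1..\<eta>}. 1 \<le> c k \<and> c k \<le> j) \<and>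
    set (trace i j) = (\<lambda>k. diag k (c k)) ` {1..\<eta>} \<and> distinct (trace i j) \<and>
    length (trace i j) = \<eta> \<and> (\<Sum>(k, l)\<leftarrow>trace i j. entry k l) = min_shift i j"
  using assms
proof (induction i arbitrary: j \<eta>)
  case 0
  then show ?case by (auto simp: monotone_on_def)
next
  case (Suc i)
  show ?case
  proof (cases \<eta>)
    case 0
    with Suc.prems show ?thesis
      by (auto simp: min_shift_above_diagonal monotone_on_def simp del: min_shift.simps)
  next
    case (Suc h)
    then have le: "j \<le> Suc i" using Suc.prems by simp
    show ?thesis
    proof (cases "1 < j \<and> min_shift i (j - 1) < min_shift i j + entry (Suc i) j")
      case True
      then have "1 \<le> j - 1" "Suc i = j - 1 + \<eta>" using Suc.prems by auto
      from Suc.IH[OF this] obtain c where c: "mono_on {1..\<eta>} c"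
        "\<forall>k \<in> {1..\<eta>}. 1 \<le> c k \<and> c k \<le> j - 1"
        "set (trace i (j - 1)) = (\<lambda>k. diag k (c k)) ` {1..\<eta>}" "distinct (trace i (j - 1))"
        "length (trace i (j - 1)) = \<eta>"
        "(\<Sum>(k, l)\<leftarrow>trace i (j - 1). entry k l) = min_shift i (j - 1)"
        by (elim exE conjE) (rule that)
      moreover have "trace (Suc i) j = trace i (j - 1)" "min_shift (Suc i) j = min_shift i (j - 1)"
        using True le by auto
      moreover have "\<forall>k \<in> {1..\<eta>}. 1 \<le> c k \<and> c k \<le> j"
        using c(2) by force
      ultimately show ?thesis by (intro exI[of _ c]) simp
    next
      case False
      have "Suc i = j + h" using Suc.prems Suc by simp
      from Suc.IH[OF Suc.prems(1) this] obtain c where c: "mono_on {1..h} c"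
        "\<forall>k \<in> {1..h}. 1 \<le> c k \<and> c k \<le> j"
        "set (trace i j) = (\<lambda>k. diag k (c k)) ` {1..h}" "distinct (trace i j)"
        "length (trace i j) = h"
        "(\<Sum>(k, l)\<leftarrow>trace i j. entry k l) = min_shift i j"
        by (elim exE conjE) (rule that)
      let ?c = "c(\<eta> := j)"
      have eqs: "trace (Suc i) j = (Suc i, j) # trace i j"
        "min_shift (Suc i) j = min_shift i j + entry (Suc i) j"
        using False le by auto
      have "(\<lambda>k. diag k (?c k)) ` {1..\<eta>} = insert (diag \<eta> j) ((\<lambda>k. diag k (c k)) ` {1..h})"
        unfolding Suc by (auto simp: atLeastAtMostSuc_conv image_iff)
      moreover have "diag \<eta> j = (Suc i, j)"
        using Suc.prems by (simp add: diag_def)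
      \<comment> \<open>A position of column \<open>j\<close> in row \<open>Suc i = j + h\<close>
        has diagonal coordinate \<open>h + 1\<close>, which exceeds every \<open>k\<close> in the
        range.\<close>
      moreover have "(Suc i, j) \<notin> (\<lambda>k. diag k (c k)) ` {1..h}"
      proof
        assume "(Suc i, j) \<in> (\<lambda>k. diag k (c k)) ` {1..h}"
        then obtain k where k: "k \<in> {1..h}" "Suc i = c k + k - 1" "j = c k"
          by (auto simp: diag_def)
        with \<open>Suc i = j + h\<close> show False by auto
      qed
      ultimately have "set (trace (Suc i) j) = (\<lambda>k. diag k (?c k)) ` {1..\<eta>}"
        "distinct (trace (Suc i) j)"
        using eqs c(3,4) by auto
      moreover have "mono_on {1..\<eta>} ?c" "\<forall>k \<in> {1..\<eta>}. 1 \<le> ?c k \<and> ?c k \<le> j"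
        using c(1,2) Suc.prems(1) Suc by (auto simp: monotone_on_def)
      moreover have "length (trace (Suc i) j) = \<eta>"
        "(\<Sum>(k, l)\<leftarrow>trace (Suc i) j. entry k l) = min_shift (Suc i) j"
        using eqs c(5,6) Suc by auto
      ultimately show ?thesis by (intro exI[of _ ?c] conjI)
    qed
  qed
qed

section \<open>Violated inequalities in terms of minimal shiftings\<close>

lemma sum_shifted_column:
  assumes "shifted_column p q \<eta> c S"
  shows "sum x S = (\<Sum>k = 1..\<eta>. entry (c k + k - 1) (c k))"
proof -
  have "inj_on (\<lambda>k. diag k (c k)) {1..\<eta>}"
    by (auto simp: inj_on_def diag_def)
  moreover have "x (diag k (c k)) = entry (c k + k - 1) (c k)" if "k \<in> {1..\<eta>}" for k
    using assms that by (force simp: shifted_column_def entry_def diag_def)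
  ultimately show ?thesis
    using assms by (simp add: shifted_column_def sum.reindex)
qed

lemma sum_bar:
  assumes "1 \<le> i" "i \<le> p" "1 \<le> j"
  shows "sum x (bar q i j) = (\<Sum>k = j..q. entry i k)"
proof -
  have "(\<Sum>k = j..q. entry i k) = (\<Sum>k = j..min i q. entry i k)"
    by (rule sum.mono_neutral_right) (auto intro!: entry_eq_0)
  also have "\<dots> = (\<Sum>k = j..min i q. x (i, k))"
    using assms by (intro sum.cong) (auto simp: entry_def index_set_def)
  also have "\<dots> = sum x (bar q i j)"
    by (simp add: bar_def sum.cartesian_product' sum.reindex)
  finally show ?thesis ..
qed

text \<open>\<open>is_shifting\<close> sees the column only as a set, so its parameters must be
  recovered: the length is the cardinality, and the column index is the only second
  coordinate.\<close>

lemma col_eqD: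
  assumes "col \<eta> j = col \<eta>' j'" "1 \<le> \<eta>" "1 \<le> \<eta>'"
  shows "\<eta> = \<eta>'" "j = j'"
proof -
  have card: "card (col h l) = h" for h l
    unfolding col_def by (subst card_image) (auto simp: inj_on_def diag_def)
  have "snd ` col h l = {l}" if "1 \<le> h" for h l
    using that by (force simp: col_def diag_def image_iff)
  then show "j = j'"
    using assms by (metis the_elem_eq)
  show "\<eta> = \<eta>'"
    using assms(1) card by metis
qed

text \<open>The column \<open>col \<eta> (j - 1)\<close> ends at \<open>(i - 1, j - 1)\<close>, so a
  bar sum exceeding \<open>sum x S\<close> also exceeds the minimum over all shiftings of that
  column.\<close>

lemma violated_if_not_satisfies:
  assumes "shifted_column_ineq p q B S" "\<not> satisfies x B S"
  shows "\<exists>i j. violated i j"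
proof -
  from assms(1) obtain \<eta> i j \<eta>' c l where *: "1 \<le> \<eta>" "2 \<le> j" "(i, j) = diag \<eta> j"
    "(i, j) \<in> index_set p q" "B = bar q i j" "shifted_column p q \<eta>' c S" "c \<eta>' \<le> l"
    "col \<eta> (j - 1) = col \<eta>' l"
    by (auto simp: shifted_column_ineq_def is_shifting_def)
  moreover have "1 \<le> \<eta>'" using *(6) by (simp add: shifted_column_def)
  ultimately have "\<eta>' = \<eta>" "l = j - 1" using col_eqD by metis+
  note * = *[unfolded this]
  have i: "i = j + \<eta> - 1" using *(3) by (simp add: diag_def)
  have mono: "mono_on {1..\<eta>} c" and S: "(\<lambda>k. diag k (c k)) ` {1..\<eta>} \<subseteq> index_set p q"
    using *(6) by (auto simp: shifted_column_def)
  have "min_shift (i - 1) (j - 1) \<le> (\<Sum>k = 1..\<eta>. entry (c k + k - 1) (c k))"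
  proof (rule min_shift_le[OF mono])
    show "c k \<le> j - 1" if "k \<in> {1..\<eta>}" for k
    proof -
      have "c k \<le> c \<eta>" using mono that by (auto simp: monotone_on_def)
      with *(7) show ?thesis by simp
    qed
    show "1 \<le> c k" if "k \<in> {1..\<eta>}" for k
      using S that by (auto simp: index_set_def diag_def image_subset_iff)
  qed (use *(1,2) i in auto)
  moreover have "sum x S < sum x B"
    using assms(2) by (simp add: satisfies_def)
  moreover have ij: "1 \<le> i" "i \<le> p" "j \<le> q"
    using *(4) by (auto simp: index_set_def)
  ultimately have "violated i j"
    using *(2,5) sum_shifted_column[OF *(6)] sum_bar[of i j] by (simp add: violated_def)
  then show ?thesis by blast
qed

lemma trace_violates:
  assumes "violated i j"
  shows "shifted_column_ineq p q (bar q i j) (set (trace (i - 1) (j - 1)))"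
    "\<not> satisfies x (bar q i j) (set (trace (i - 1) (j - 1)))"
    "distinct (trace (i - 1) (j - 1))" "length (trace (i - 1) (j - 1)) = i + 1 - j"
proof -
  have ij: "1 \<le> i" "i \<le> p" "2 \<le> j" "j \<le> q" "j \<le> i"
    using assms violated_below_diagonal[OF assms] by (auto simp: violated_def)
  define \<eta> where "\<eta> = i + 1 - j"
  define S where "S = set (trace (i - 1) (j - 1))"
  have eta: "1 \<le> \<eta>" "i = j + \<eta> - 1"
    using ij by (auto simp: \<eta>_def)
  have "1 \<le> j - 1" "Suc (i - 1) = j - 1 + \<eta>"
    using ij by (auto simp: \<eta>_def)
  from trace_spec[OF this] obtain c where c: "mono_on {1..\<eta>} c"
    "\<forall>k \<in> {1..\<eta>}. 1 \<le> c k \<and> c k \<le> j - 1" "S = (\<lambda>k. diag k (c k)) ` {1..\<eta>}"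
    "distinct (trace (i - 1) (j - 1))" "length (trace (i - 1) (j - 1)) = \<eta>"
    "(\<Sum>(k, l)\<leftarrow>trace (i - 1) (j - 1). entry k l) = min_shift (i - 1) (j - 1)"
    by (elim exE conjE) (rule that, simp_all add: S_def)
  show "distinct (trace (i - 1) (j - 1))" "length (trace (i - 1) (j - 1)) = i + 1 - j"
    using c(4,5) by (simp_all add: \<eta>_def)
  \<comment> \<open>An index of at most \<open>j - 1\<close> at place \<open>k \<le> \<eta>\<close>
    yields a row of at most \<open>j + \<eta> - 2 = i - 1\<close>.\<close>
  have S: "S \<subseteq> index_set p q"
  proof
    fix z assume "z \<in> S"
    then obtain k where k: "k \<in> {1..\<eta>}" "z = diag k (c k)" using c(3) by blast
    with c(2) have "1 \<le> c k" "c k \<le> j - 1" by auto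
    with k eta ij show "z \<in> index_set p q"
      by (auto simp: diag_def index_set_def)
  qed
  have shifted: "shifted_column p q \<eta> c S"
    using eta c S by (simp add: shifted_column_def)
  moreover have "c \<eta> \<le> j - 1" using c(2) eta by simp
  moreover have "diag \<eta> (j - 1) \<in> index_set p q"
    using ij eta by (auto simp: diag_def index_set_def)
  moreover have "j - 1 \<le> q" using ij by simp
  ultimately have "is_shifting p q S (col \<eta> (j - 1))"
    unfolding is_shifting_def by blast
  moreover have "(i, j) = diag \<eta> j" "(i, j) \<in> index_set p q"
    using eta ij by (auto simp: diag_def index_set_def)
  ultimately show "shifted_column_ineq p q (bar q i j) (set (trace (i - 1) (j - 1)))"
    unfolding shifted_column_ineq_def S_def[symmetric] using eta ij by blast
  have "sum x S = (\<Sum>z\<in>S. entry (fst z) (snd z))"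
    using S by (intro sum.cong) (auto simp: entry_def)
  also have "\<dots> = min_shift (i - 1) (j - 1)"
    using c(4,6) by (simp add: S_def sum_list_distinct_conv_sum_set case_prod_unfold)
  finally show "\<not> satisfies x (bar q i j) (set (trace (i - 1) (j - 1)))"
    using assms ij sum_bar[of i j] by (simp add: satisfies_def violated_def S_def)
qed

section \<open>Encoding of answers and of the input array\<close>

abbreviation flat :: "(nat \<times> nat) list \<Rightarrow> nat list" where
  "flat ps \<equiv> concat (map (\<lambda>(i, j). [i, j]) ps)"

lemma correct_answer_if_violated:
  assumes "violated i j"
  shows "correct_answer p q x
    ([1, Suc (min i q) - j] @ flat (map (Pair i) [j..<Suc (min i q)]) @
     [i + 1 - j] @ flat (trace (i - 1) (j - 1)))"
proof -
  note t = trace_violates[OF assms]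
  have "set (map (Pair i) [j..<Suc (min i q)]) = bar q i j"
    by (auto simp: bar_def image_iff simp del: upt_Suc)
  moreover have "distinct (map (Pair i) [j..<Suc (min i q)])"
    by (simp add: distinct_map inj_on_def del: upt_Suc)
  ultimately have "\<exists>bs ss. [1, Suc (min i q) - j] @ flat (map (Pair i) [j..<Suc (min i q)]) @
      [i + 1 - j] @ flat (trace (i - 1) (j - 1)) = 1 # encode_positions bs @ encode_positions ss \<and>
      distinct bs \<and> distinct ss \<and>
      shifted_column_ineq p q (set bs) (set ss) \<and> \<not> satisfies x (set bs) (set ss)"
    using t by (intro exI[of _ "map (Pair i) [j..<Suc (min i q)]"]
        exI[of _ "trace (i - 1) (j - 1)"]) (simp add: encode_positions_def del: upt_Suc)
  moreover have "\<not> (\<forall>B S. shifted_column_ineq p q B S \<longrightarrow> satisfies x B S)"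
    using t by blast
  ultimately show ?thesis
    unfolding correct_answer_def by (simp only: if_False)
qed

lemma correct_answer_if_not_violated:
  "(\<And>i j. \<not> violated i j) \<Longrightarrow> correct_answer p q x [0]"
  using violated_if_not_satisfies by (auto simp: correct_answer_def)

lemma input_array_eq_entry:
  assumes "1 \<le> i" "1 \<le> j" "j \<le> q"
  shows "input_array p q x ((i - 1) * q + (j - 1)) = entry i j"
proof -
  have "j - 1 < q" using assms by simp
  then have "((i - 1) * q + (j - 1)) div q = i - 1" "((i - 1) * q + (j - 1)) mod q = j - 1"
    by (simp_all del: One_nat_def)
  then show ?thesis
    using assms by (simp add: input_array_def entry_def)
qed

end


section \<open>Reasoning about programs and their running times\<close>

text \<open>The postcondition refers to the final state and to the time \<open>t\<close> already spent before the
  program plus its own running time.\<close>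

definition wp :: "com \<Rightarrow> (state \<Rightarrow> nat \<Rightarrow> bool) \<Rightarrow> state \<Rightarrow> nat \<Rightarrow> bool" where
  "wp c Q s t \<longleftrightarrow> (\<exists>u s'. exec c s u s' \<and> Q s' (t + u))"

text \<open>Determinism of \<open>exec\<close> turns the existential in \<open>wp\<close> into an
  equivalence, which serves as a rewrite rule for basic commands.\<close>

lemma wp_exec: "exec c s u s' \<Longrightarrow> wp c Q s t \<longleftrightarrow> Q s' (t + u)"
  unfolding wp_def using exec_deterministic by blast

lemmas wp_basic [simp] =
  exec.Skip [THEN wp_exec] exec.ISet [THEN wp_exec] exec.RSet [THEN wp_exec]
  exec.RStore [THEN wp_exec] exec.Write [THEN wp_exec]

lemma wp_Seq [simp]: "wp (Seq c1 c2) Q s t \<longleftrightarrow> wp c1 (wp c2 Q) s t"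
  unfolding wp_def by (auto elim!: SeqE simp: add.assoc) (metis exec.Seq add.assoc)

lemma wp_If [simp]:
  "wp (If b c1 c2) Q s t \<longleftrightarrow>
     (if tval b s then wp c1 Q s (t + tcost b) else wp c2 Q s (t + tcost b))"
  unfolding wp_def by (auto elim!: IfE simp: add.assoc) (metis exec.IfTrue exec.IfFalse)+

text \<open>The invariant also sees the elapsed time, so running time bounds are ordinary
  invariants. The measure \<open>m\<close> is needed because \<open>wp\<close> demands
  termination.\<close>

lemma wp_While:
  fixes m :: "state \<Rightarrow> nat"
  assumes "I s t"
    and step: "\<And>s t. I s t \<Longrightarrow> tval b s \<Longrightarrow> wp c (\<lambda>s' t'. I s' t' \<and> m s' < m s) s (t + tcost b)"
    and exit: "\<And>s t. I s t \<Longrightarrow> \<not> tval b s \<Longrightarrow> Q s (t + tcost b)"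
  shows "wp (While b c) Q s t"
  using assms(1)
proof (induction "m s" arbitrary: s t rule: less_induct)
  case less
  show ?case
  proof (cases "tval b s")
    case True
    from step[OF less.prems True] obtain u s1
      where 1: "exec c s u s1" "I s1 (t + tcost b + u)" "m s1 < m s"
      by (auto simp: wp_def)
    from less.hyps[OF 1(3,2)] obtain v s2
      where "exec (While b c) s1 v s2" "Q s2 (t + tcost b + u + v)"
      by (auto simp: wp_def)
    with 1(1) True show ?thesis
      unfolding wp_def by (metis exec.WhileTrue add.assoc)
  next
    case False
    with exit[OF less.prems] show ?thesis
      unfolding wp_def by (metis exec.WhileFalse)
  qed
qed


section \<open>The separation program\<close>

text \<open>
  Integer variables: \<open>2\<close> and \<open>3\<close> hold the current position \<open>(i, j)\<close>, \<open>4\<close> and \<open>5\<close> the start of a bar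
  in a violated inequality (\<open>0\<close> if none is known), \<open>6\<close> the last column of that bar, and \<open>7\<close>
  runs through its columns. Rational variable \<open>0\<close> holds a bar sum, and rational array \<open>1\<close>
  holds \<open>min_shift i j\<close> at address \<open>i * q + j\<close> for \<open>1 \<le> j \<le> q\<close>.
\<close>

text \<open>The address of \<open>x (i, j)\<close> coincides with that of \<open>min_shift (i - 1) (j - 1)\<close>.\<close>

definition entry_addr :: iexp where
  "entry_addr = IAdd (IMul (ISub (IVar 2) (IConst 1)) (IVar 1)) (ISub (IVar 3) (IConst 1))"

definition above_addr :: iexp where
  "above_addr = IAdd (IMul (ISub (IVar 2) (IConst 1)) (IVar 1)) (IVar 3)"

definition here_addr :: iexp where
  "here_addr = IAdd (IMul (IVar 2) (IVar 1)) (IVar 3)"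

definition extended_sum :: rexp where
  "extended_sum = RAdd (RElem 1 above_addr) (RElem 0 entry_addr)"

text \<open>Tests are atomic, so the conjunction becomes two nested conditionals. The guard comes
  first because in column 1 the address \<open>entry_addr\<close> does not belong to row
  \<open>i - 1\<close> of the table. Filling the table and retracing share this test.\<close>

definition if_shift :: "com \<Rightarrow> com \<Rightarrow> com" where
  "if_shift c1 c2 =
     If (ILess (IConst 1) (IVar 3)) (If (RLess (RElem 1 entry_addr) extended_sum) c1 c2) c2"

definition record_violation :: com where
  "record_violation =
     If (ILess (IConst 1) (IVar 3))
       (If (RLess (RElem 1 entry_addr) (RVar 0)) (Seq (ISet 4 (IVar 2)) (ISet 5 (IVar 3))) Skip)
       Skip"

definition store_min_shift :: com where
  "store_min_shift =
     if_shift (RStore 1 here_addr (RElem 1 entry_addr)) (RStore 1 here_addr extended_sum)"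

text \<open>As columns run downwards, one addition turns the running total into the sum of the bar
  starting here. Table values depend only on the previous row, so this order suits them too.\<close>

definition scan_entry :: com where
  "scan_entry =
     Seq (RSet 0 (RAdd (RVar 0) (RElem 0 entry_addr)))
       (Seq record_violation (Seq store_min_shift (ISet 3 (ISub (IVar 3) (IConst 1)))))"

definition scan_row :: com where
  "scan_row =
     Seq (ISet 3 (IVar 1)) (Seq (RSet 0 (RConst 0))
       (Seq (While (ILess (IConst 0) (IVar 3)) scan_entry) (ISet 2 (IAdd (IVar 2) (IConst 1)))))"

definition scan :: com where
  "scan = Seq (ISet 2 (IConst 1)) (While (ILess (IVar 2) (IAdd (IVar 0) (IConst 1))) scan_row)"

definition write_bar :: com where
  "write_bar =
     Seq (ISet 6 (IVar 4)) (Seq (If (ILess (IVar 1) (IVar 6)) (ISet 6 (IVar 1)) Skip)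
       (Seq (Write (ISub (IAdd (IVar 6) (IConst 1)) (IVar 5))) (Seq (ISet 7 (IVar 5))
         (While (ILess (IVar 7) (IAdd (IVar 6) (IConst 1)))
           (Seq (Write (IVar 4)) (Seq (Write (IVar 7)) (ISet 7 (IAdd (IVar 7) (IConst 1)))))))))"

definition trace_step :: com where
  "trace_step =
     if_shift (Seq (ISet 2 (ISub (IVar 2) (IConst 1))) (ISet 3 (ISub (IVar 3) (IConst 1))))
       (Seq (Write (IVar 2)) (Seq (Write (IVar 3)) (ISet 2 (ISub (IVar 2) (IConst 1)))))"

text \<open>The length precedes the list, so it is written from the closed form
  \<open>i + 1 - j\<close> before the positions are found. The loop runs while the current column is
  nonempty.\<close>

definition write_trace :: com where
  "write_trace =
     Seq (Write (ISub (IAdd (IVar 4) (IConst 1)) (IVar 5)))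
       (Seq (ISet 2 (ISub (IVar 4) (IConst 1))) (Seq (ISet 3 (ISub (IVar 5) (IConst 1)))
         (While (ILess (IVar 3) (IAdd (IVar 2) (IConst 1))) trace_step)))"

definition separate :: com where
  "separate =
     Seq scan (If (ILess (IConst 0) (IVar 4)) (Seq (Write (IConst 1)) (Seq write_bar write_trace))
       (Write (IConst 0)))"

lemma cost_simps [simp]:
  "icost entry_addr = 9" "icost above_addr = 7" "icost here_addr = 5" "rcost extended_sum = 19"
  by (simp_all add: entry_addr_def above_addr_def here_addr_def extended_sum_def)

section \<open>Invariants and layout of the table\<close>

context separation
begin

declare One_nat_def [simp del]

text \<open>The positions scanned when column \<open>j\<close> is the next one in row \<open>i\<close>; rows are scanned upwards
  from \<open>1\<close>, the columns of a row downwards from \<open>q\<close>.\<close>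

definition scanned :: "nat \<Rightarrow> nat \<Rightarrow> nat \<Rightarrow> nat \<Rightarrow> bool" where
  "scanned i j k l \<longleftrightarrow> 1 \<le> l \<and> l \<le> q \<and> (k < i \<or> k = i \<and> j < l)"

definition has_input :: "state \<Rightarrow> bool" where
  "has_input s \<longleftrightarrow> ivar s 0 = p \<and> ivar s 1 = q \<and> rarr s 0 = input_array p q x"

definition has_table :: "nat \<Rightarrow> nat \<Rightarrow> state \<Rightarrow> bool" where
  "has_table i j s \<longleftrightarrow> (\<forall>k l. scanned i j k l \<longrightarrow> rarr s 1 (k * q + l) = min_shift k l)"

text \<open>The value 0 can signal that nothing is recorded because no violation lies in row
  0.\<close>

definition has_record :: "nat \<Rightarrow> nat \<Rightarrow> state \<Rightarrow> bool" where
  "has_record i j s \<longleftrightarrow>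
     (if ivar s 4 = 0 then \<forall>k l. scanned i j k l \<longrightarrow> \<not> violated k l
      else violated (ivar s 4) (ivar s 5))"

lemma scanned_pred:
  "1 \<le> j \<Longrightarrow> j \<le> q \<Longrightarrow> scanned i (j - 1) k l \<longleftrightarrow> scanned i j k l \<or> k = i \<and> l = j"
  by (auto simp: scanned_def)

lemma scanned_Suc_row: "scanned (Suc i) q k l \<longleftrightarrow> scanned i 0 k l"
  by (auto simp: scanned_def)

text \<open>Columns are numbered from 1 to \<open>q\<close>, so they are lowered by one before row
  and column are read off by division with remainder. Hence storing one table value never disturbs
  another.\<close>

lemma address_inj:
  assumes "k * q + l = k' * q + l'" "1 \<le> l" "l \<le> q" "1 \<le> l'" "l' \<le> q"
  shows "k = k' \<and> l = l'"
proof -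
  obtain m m' where "l = Suc m" "l' = Suc m'"
    using assms(2,4) by (metis Suc_le_D One_nat_def)
  with assms have "m < q" "m' < q" "k * q + m = k' * q + m'" by auto
  moreover have "(n * q + r) div q = n" "(n * q + r) mod q = r" if "r < q" for n r
    using that by simp_all
  ultimately show ?thesis using \<open>l = Suc m\<close> \<open>l' = Suc m'\<close> by metis
qed

lemma min_shift_unfold:
  "1 \<le> i \<Longrightarrow> min_shift i j =
     (if 1 < j \<and> min_shift (i - 1) (j - 1) < min_shift (i - 1) j + entry i j
      then min_shift (i - 1) (j - 1) else min_shift (i - 1) j + entry i j)"
  by (cases i) simp_all

lemma trace_unfold:
  "1 \<le> j \<Longrightarrow> j \<le> i \<Longrightarrow> trace i j =
     (if 1 < j \<and> min_shift (i - 1) (j - 1) < min_shift (i - 1) j + entry i j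
      then trace (i - 1) (j - 1) else (i, j) # trace (i - 1) j)"
  by (cases i) simp_all

definition at_entry :: "nat \<Rightarrow> nat \<Rightarrow> state \<Rightarrow> bool" where
  "at_entry i j s \<longleftrightarrow> has_input s \<and> has_table i j s \<and> ivar s 2 = i \<and> ivar s 3 = j \<and>
     1 \<le> i \<and> 1 \<le> j \<and> j \<le> q"

text \<open>Both table accesses go to row \<open>i - 1\<close>, which is completely scanned.\<close>

lemma read_table:
  assumes "at_entry i j s"
  shows "rval (RElem 0 entry_addr) s = entry i j"
    "1 < j \<Longrightarrow> rval (RElem 1 entry_addr) s = min_shift (i - 1) (j - 1)"
    "rval extended_sum s = min_shift (i - 1) j + entry i j"
    "ival here_addr s = i * q + j"
proof -
  have a: "has_input s" "has_table i j s" "ivar s 2 = i" "ivar s 3 = j" "1 \<le> i" "1 \<le> j" "j \<le> q"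
    using assms by (auto simp: at_entry_def)
  show e: "rval (RElem 0 entry_addr) s = entry i j"
    using a input_array_eq_entry[of i j] by (simp add: has_input_def entry_addr_def)
  have "scanned i j (i - 1) j" using a by (auto simp: scanned_def)
  then have "rval (RElem 1 above_addr) s = min_shift (i - 1) j"
    using a by (simp add: has_input_def has_table_def above_addr_def)
  with e show "rval extended_sum s = min_shift (i - 1) j + entry i j"
    by (simp add: extended_sum_def)
  show "rval (RElem 1 entry_addr) s = min_shift (i - 1) (j - 1)" if "1 < j"
  proof -
    have "scanned i j (i - 1) (j - 1)" using a that by (auto simp: scanned_def)
    then have "rarr s 1 ((i - 1) * q + (j - 1)) = min_shift (i - 1) (j - 1)"
      using a(2) unfolding has_table_def by blast
    then show ?thesis
      using a by (simp add: has_input_def entry_addr_def)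
  qed
  show "ival here_addr s = i * q + j"
    using a by (simp add: has_input_def here_addr_def)
qed

section \<open>Correctness and running time of the scan\<close>

lemma wp_if_shift:
  assumes "at_entry i j s"
    and "\<And>u. u \<le> t + 33 \<Longrightarrow> 1 < j \<Longrightarrow> min_shift (i - 1) (j - 1) < min_shift (i - 1) j + entry i j \<Longrightarrow>
      wp c1 Q s u"
    and "\<And>u. u \<le> t + 33 \<Longrightarrow> \<not> (1 < j \<and> min_shift (i - 1) (j - 1) < min_shift (i - 1) j + entry i j) \<Longrightarrow>
      wp c2 Q s u"
  shows "wp (if_shift c1 c2) Q s t"
proof -
  have "ivar s 3 = j" using assms(1) by (simp add: at_entry_def)
  then show ?thesis
    using assms(2,3) read_table[OF assms(1)]
    by (auto simp: if_shift_def)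
qed

lemma wp_store_min_shift:
  assumes "at_entry i j s"
    and "\<And>s' t'. s' = s\<lparr>rarr := (rarr s)(1 := (rarr s 1)(i * q + j := min_shift i j))\<rparr> \<Longrightarrow>
      has_table i (j - 1) s' \<Longrightarrow> t' \<le> t + 60 \<Longrightarrow> Q s' t'"
  shows "wp store_min_shift Q s t"
proof -
  let ?s = "s\<lparr>rarr := (rarr s)(1 := (rarr s 1)(i * q + j := min_shift i j))\<rparr>"
  have a: "has_table i j s" "1 \<le> i" "1 \<le> j" "j \<le> q"
    using assms(1) by (auto simp: at_entry_def)
  have "has_table i (j - 1) ?s"
    unfolding has_table_def
  proof (intro allI impI)
    fix k l
    assume *: "scanned i (j - 1) k l"
    show "rarr ?s 1 (k * q + l) = min_shift k l"
    proof (cases "k = i \<and> l = j")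
      case False
      with * a have "scanned i j k l" "1 \<le> l" "l \<le> q"
        by (auto simp: scanned_pred scanned_def)
      with False a address_inj[of k l i j] show ?thesis
        by (auto simp: has_table_def)
    qed simp
  qed
  then have Q: "Q ?s t'" if "t' \<le> t + 60" for t'
    using assms(2) that by blast
  show ?thesis
    unfolding store_min_shift_def
  proof (rule wp_if_shift[OF assms(1)])
    fix u
    assume "u \<le> t + 33" and shift: "1 < j" "min_shift (i - 1) (j - 1) < min_shift (i - 1) j + entry i j"
    moreover have "min_shift i j = min_shift (i - 1) (j - 1)"
      using shift a by (subst min_shift_unfold) auto
    ultimately show "wp (RStore 1 here_addr (RElem 1 entry_addr)) Q s u"
      using read_table[OF assms(1)] Q by simp
  next
    fix u
    assume "u \<le> t + 33"
      and "\<not> (1 < j \<and> min_shift (i - 1) (j - 1) < min_shift (i - 1) j + entry i j)"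
    moreover from this have "min_shift i j = min_shift (i - 1) j + entry i j"
      using a by (subst min_shift_unfold) auto
    ultimately show "wp (RStore 1 here_addr extended_sum) Q s u"
      using read_table[OF assms(1)] Q by simp
  qed
qed

lemma wp_record_violation:
  assumes "at_entry i j s" "i \<le> p" "rvar s 0 = (\<Sum>k = j..q. entry i k)" "has_record i j s"
    and "\<And>s' t'. at_entry i j s' \<Longrightarrow> has_record i (j - 1) s' \<Longrightarrow> rvar s' = rvar s \<Longrightarrow>
      out s' = out s \<Longrightarrow> t' \<le> t + 30 \<Longrightarrow> Q s' t'"
  shows "wp record_violation Q s t"
proof -
  have a: "has_input s" "has_table i j s" "ivar s 2 = i" "ivar s 3 = j" "1 \<le> i" "1 \<le> j" "j \<le> q"
    using assms(1) by (auto simp: at_entry_def)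
  have violated_iff: "violated i j \<longleftrightarrow> 1 < j \<and> rval (RElem 1 entry_addr) s < rvar s 0"
    using a assms(2,3) read_table(2)[OF assms(1)] by (auto simp: violated_def)
  show ?thesis
  proof (cases "violated i j")
    case True
    let ?s = "s\<lparr>ivar := (ivar s)(4 := i, 5 := j)\<rparr>"
    have "at_entry i j ?s" "has_record i (j - 1) ?s"
      using a True by (auto simp: at_entry_def has_input_def has_table_def has_record_def)
    from assms(5)[OF this] show ?thesis
      using True a unfolding violated_iff by (simp add: record_violation_def)
  next
    case False
    have "has_record i (j - 1) s"
      using False assms(4) a by (auto simp: has_record_def scanned_pred)
    from assms(5)[OF assms(1) this] show ?thesis
      using False a unfolding violated_iff by (auto simp: record_violation_def)
  qed
qed

lemma wp_scan_entry:
  assumes "at_entry i j s" "i \<le> p" "rvar s 0 = (\<Sum>k = Suc j..q. entry i k)" "has_record i j s"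
    "out s = []"
    and "\<And>s' t'. has_input s' \<Longrightarrow> has_table i (j - 1) s' \<Longrightarrow> has_record i (j - 1) s' \<Longrightarrow>
      ivar s' 2 = i \<Longrightarrow> ivar s' 3 = j - 1 \<Longrightarrow> rvar s' 0 = (\<Sum>k = j..q. entry i k) \<Longrightarrow>
      out s' = [] \<Longrightarrow> t' \<le> t + 120 \<Longrightarrow> Q s' t'"
  shows "wp scan_entry Q s t"
proof -
  have j: "1 \<le> j" "j \<le> q" using assms(1) by (auto simp: at_entry_def)
  let ?s = "s\<lparr>rvar := (rvar s)(0 := \<Sum>k = j..q. entry i k)\<rparr>"
  have "(\<Sum>k = j..q. entry i k) = entry i j + (\<Sum>k = Suc j..q. entry i k)"
    using j by (simp add: sum.atLeast_Suc_atMost)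
  then have "s\<lparr>rvar := (rvar s)(0 := rval (RAdd (RVar 0) (RElem 0 entry_addr)) s)\<rparr> = ?s"
    using read_table(1)[OF assms(1)] assms(3) by (simp add: add.commute)
  moreover have "wp record_violation (wp (Seq store_min_shift (ISet 3 (ISub (IVar 3) (IConst 1)))) Q)
    ?s (t + 13)"
  proof (rule wp_record_violation)
    show "at_entry i j ?s" "has_record i j ?s"
      using assms(1,4) by (auto simp: at_entry_def has_input_def has_table_def has_record_def)
    fix s1 t1
    assume s1: "at_entry i j s1" "has_record i (j - 1) s1" "rvar s1 = rvar ?s" "out s1 = out ?s"
      "t1 \<le> t + 13 + 30"
    show "wp (Seq store_min_shift (ISet 3 (ISub (IVar 3) (IConst 1)))) Q s1 t1"
      unfolding wp_Seq
    proof (rule wp_store_min_shift[OF s1(1)])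
      fix s2 t2
      assume s2: "s2 = s1\<lparr>rarr := (rarr s1)(1 := (rarr s1 1)(i * q + j := min_shift i j))\<rparr>"
        "has_table i (j - 1) s2" "t2 \<le> t1 + 60"
      let ?s3 = "s2\<lparr>ivar := (ivar s2)(3 := j - 1)\<rparr>"
      have "Q ?s3 (t2 + 4)"
      proof (rule assms(6))
        show "has_input ?s3" "has_record i (j - 1) ?s3" "ivar ?s3 2 = i"
          using s1 s2(1) by (auto simp: at_entry_def has_input_def has_record_def)
        show "has_table i (j - 1) ?s3"
          using s2(2) by (simp add: has_table_def)
      qed (use s1 s2 assms(5) in auto)
      then show "wp (ISet 3 (ISub (IVar 3) (IConst 1))) Q s2 t2"
        using s1(1) s2(1) by (simp add: at_entry_def)
    qed
  qed (use assms(2) in auto)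
  ultimately show ?thesis
    by (simp add: scan_entry_def)
qed

definition at_row :: "nat \<Rightarrow> state \<Rightarrow> bool" where
  "at_row i s \<longleftrightarrow> has_input s \<and> has_table i q s \<and> has_record i q s \<and> ivar s 2 = i \<and> out s = []"

lemma wp_scan_row:
  assumes "at_row i s" "1 \<le> i" "i \<le> p"
    and "\<And>s' t'. at_row (Suc i) s' \<Longrightarrow> t' \<le> t + 200 * q \<Longrightarrow> Q s' t'"
  shows "wp scan_row Q s t"
proof -
  \<comment> \<open>One entry costs at most 120, plus 3 for the loop test. The 4 units precede the
    loop.\<close>
  define I where "I s' t' \<longleftrightarrow> (\<exists>j \<le> q. has_input s' \<and> has_table i j s' \<and> has_record i j s' \<and>
    ivar s' 2 = i \<and> ivar s' 3 = j \<and> rvar s' 0 = (\<Sum>k = Suc j..q. entry i k) \<and> out s' = [] \<and>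
    t' + 123 * j \<le> t + 4 + 123 * q)" for s' t'
  have "wp (While (ILess (IConst 0) (IVar 3)) scan_entry) (wp (ISet 2 (IAdd (IVar 2) (IConst 1))) Q)
    (s\<lparr>ivar := (ivar s)(3 := q), rvar := (rvar s)(0 := 0)\<rparr>) (t + 4)"
  proof (rule wp_While[where I = I and m = "\<lambda>s. ivar s 3"])
    show "I (s\<lparr>ivar := (ivar s)(3 := q), rvar := (rvar s)(0 := 0)\<rparr>) (t + 4)"
      using assms(1)
      by (auto simp: I_def at_row_def has_input_def has_table_def has_record_def)
  next
    fix s1 t1
    assume "I s1 t1" "tval (ILess (IConst 0) (IVar 3)) s1"
    then obtain j where j: "0 < j" "j \<le> q" "has_input s1" "has_table i j s1" "has_record i j s1"
      "ivar s1 2 = i" "ivar s1 3 = j" "rvar s1 0 = (\<Sum>k = Suc j..q. entry i k)" "out s1 = []"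
      "t1 + 123 * j \<le> t + 4 + 123 * q"
      by (auto simp: I_def)
    have "at_entry i j s1"
      using j assms(2) by (simp add: at_entry_def)
    then show "wp scan_entry (\<lambda>s' t'. I s' t' \<and> ivar s' 3 < ivar s1 3) s1
      (t1 + tcost (ILess (IConst 0) (IVar 3)))"
      using assms(3) j by (elim wp_scan_entry) (auto simp: I_def intro!: exI[of _ "j - 1"])
  next
    fix s1 t1
    assume "I s1 t1" "\<not> tval (ILess (IConst 0) (IVar 3)) s1"
    then have s1: "has_input s1" "has_table i 0 s1" "has_record i 0 s1"
      "ivar s1 2 = i" "out s1 = []" "t1 \<le> t + 4 + 123 * q"
      by (auto simp: I_def)
    have "at_row (Suc i) (s1\<lparr>ivar := (ivar s1)(2 := Suc i)\<rparr>)"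
      using s1 by (auto simp: at_row_def has_input_def has_table_def has_record_def scanned_Suc_row)
    then show "wp (ISet 2 (IAdd (IVar 2) (IConst 1))) Q s1 (t1 + tcost (ILess (IConst 0) (IVar 3)))"
      using s1 assms(4) q_ge_2 by (simp add: Suc_eq_plus1)
  qed
  moreover have "ivar s 1 = q"
    using assms(1) by (simp add: at_row_def has_input_def)
  ultimately show ?thesis
    by (simp add: scan_row_def numeral_eq_Suc)
qed

lemma wp_scan:
  assumes "\<And>s t. at_row (Suc p) s \<Longrightarrow> t \<le> 10 + 210 * (p * q) \<Longrightarrow> Q s t"
  shows "wp scan Q (initial_state p q x) 0"
proof -
  \<comment> \<open>A row costs at most \<open>200 * q\<close>, and the loop test of cost 5 fits
    into another \<open>5 * q\<close>. Adding \<open>205 * q\<close> on the left avoids truncated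
    subtraction in \<open>i - 1\<close>.\<close>
  define I where "I s t \<longleftrightarrow> (\<exists>i \<ge> 1. i \<le> Suc p \<and> at_row i s \<and> t + 205 * q \<le> 2 + 205 * q * i)"
    for s t
  let ?s = "(initial_state p q x)\<lparr>ivar := (ivar (initial_state p q x))(2 := 1)\<rparr>"
  have "wp (While (ILess (IVar 2) (IAdd (IVar 0) (IConst 1))) scan_row) Q ?s 2"
  proof (rule wp_While[where I = I and m = "\<lambda>s. Suc p - ivar s 2"])
    \<comment> \<open>Only row 0 counts as scanned at the start, and the zero-initialised array
      already holds its correct values.\<close>
    have "min_shift k l = 0" if "scanned 1 q k l" for k l
      using that by (auto simp: scanned_def)
    moreover have "\<not> violated k l" if "scanned 1 q k l" for k l
      using that by (auto simp: scanned_def violated_def)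
    ultimately have "at_row 1 ?s"
      by (auto simp: at_row_def initial_state_def has_input_def has_table_def has_record_def)
    then show "I ?s 2"
      unfolding I_def by (intro exI[of _ 1]) simp
  next
    fix s1 t1
    assume "I s1 t1" "tval (ILess (IVar 2) (IAdd (IVar 0) (IConst 1))) s1"
    then obtain i where i: "1 \<le> i" "i \<le> p" "at_row i s1" "ivar s1 2 = i"
      "t1 + 205 * q \<le> 2 + 205 * q * i"
      by (auto simp: I_def at_row_def has_input_def)
    show "wp scan_row (\<lambda>s' t'. I s' t' \<and> Suc p - ivar s' 2 < Suc p - ivar s1 2) s1
      (t1 + tcost (ILess (IVar 2) (IAdd (IVar 0) (IConst 1))))"
    proof (rule wp_scan_row[OF i(3,1,2)])
      fix s2 t2
      assume *: "at_row (Suc i) s2"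
        "t2 \<le> t1 + tcost (ILess (IVar 2) (IAdd (IVar 0) (IConst 1))) + 200 * q"
      then have "t2 + 205 * q \<le> 2 + 205 * q * Suc i"
        using i(5) q_ge_2 by simp
      with * i show "I s2 t2 \<and> Suc p - ivar s2 2 < Suc p - ivar s1 2"
        by (auto simp: I_def at_row_def intro!: exI[of _ "Suc i"])
    qed
  next
    fix s1 t1
    assume "I s1 t1" "\<not> tval (ILess (IVar 2) (IAdd (IVar 0) (IConst 1))) s1"
    moreover from this obtain i where "i \<le> Suc p" "at_row i s1" "t1 + 205 * q \<le> 2 + 205 * q * i"
      unfolding I_def by blast
    moreover from calculation have "i = Suc p"
      by (auto simp: at_row_def has_input_def)
    ultimately show "Q s1 (t1 + tcost (ILess (IVar 2) (IAdd (IVar 0) (IConst 1))))"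
      by (intro assms) (simp_all add: algebra_simps)
  qed
  then show ?thesis
    by (simp add: scan_def numeral_eq_Suc)
qed

section \<open>Correctness and running time of the output phase\<close>

lemma wp_write_bar:
  assumes "has_input s" "ivar s 4 = i" "ivar s 5 = j" "j \<le> Suc (min i q)"
    and "\<And>s' t'. has_input s' \<Longrightarrow> rarr s' = rarr s \<Longrightarrow> ivar s' 4 = i \<Longrightarrow> ivar s' 5 = j \<Longrightarrow>
      out s' = out s @ [Suc (min i q) - j] @ flat (map (Pair i) [j..<Suc (min i q)]) \<Longrightarrow>
      t' \<le> t + 60 + 30 * q \<Longrightarrow> Q s' t'"
  shows "wp write_bar Q s t"
proof -
  let ?m = "min i q"
  define I where "I s' t' \<longleftrightarrow> has_input s' \<and> rarr s' = rarr s \<and> ivar s' 4 = i \<and> ivar s' 5 = j \<and>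
    ivar s' 6 = ?m \<and> j \<le> ivar s' 7 \<and> ivar s' 7 \<le> Suc ?m \<and>
    out s' = out s @ [Suc ?m - j] @ flat (map (Pair i) [j..<ivar s' 7]) \<and>
    t' \<le> t + 20 + 20 * ivar s' 7" for s' t'
  have loop: "wp (While (ILess (IVar 7) (IAdd (IVar 6) (IConst 1)))
      (Seq (Write (IVar 4)) (Seq (Write (IVar 7)) (ISet 7 (IAdd (IVar 7) (IConst 1)))))) Q s1 t1"
    if "I s1 t1" for s1 t1
    using that
  proof (rule wp_While[where m = "\<lambda>s. Suc ?m - ivar s 7"])
    fix s2 t2
    assume "I s2 t2" "tval (ILess (IVar 7) (IAdd (IVar 6) (IConst 1))) s2"
    then show "wp (Seq (Write (IVar 4)) (Seq (Write (IVar 7)) (ISet 7 (IAdd (IVar 7) (IConst 1)))))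
      (\<lambda>s' t'. I s' t' \<and> Suc ?m - ivar s' 7 < Suc ?m - ivar s2 7) s2
      (t2 + tcost (ILess (IVar 7) (IAdd (IVar 6) (IConst 1))))"
      by (auto simp: I_def has_input_def simp flip: Suc_eq_plus1)
  next
    fix s2 t2
    assume I: "I s2 t2" and "\<not> tval (ILess (IVar 7) (IAdd (IVar 6) (IConst 1))) s2"
    then have "ivar s2 7 = Suc ?m" by (auto simp: I_def)
    then show "Q s2 (t2 + tcost (ILess (IVar 7) (IAdd (IVar 6) (IConst 1))))"
      using I by (intro assms(5)) (auto simp: I_def simp del: upt_Suc)
  qed
  have I: "I (s\<lparr>out := out s @ [Suc ?m - j], ivar := (ivar s)(6 := ?m, 7 := j)\<rparr>) t'"
    if "t' \<le> t + 20" for t'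
    using assms(1-4) that by (auto simp: I_def has_input_def)
  have "ivar s 1 = q"
    using assms(1) by (simp add: has_input_def)
  show ?thesis
  proof (cases "q < i")
    case True
    with I have "I (s\<lparr>out := out s @ [Suc q - j], ivar := (ivar s)(6 := q, 7 := j)\<rparr>) t'"
      if "t' \<le> t + 20" for t'
      using that by (simp add: min_def)
    then show ?thesis
      unfolding write_bar_def using assms(2,3) True \<open>ivar s 1 = q\<close>
      by (auto intro!: loop simp flip: Suc_eq_plus1)
  next
    case False
    with I have "I (s\<lparr>out := out s @ [Suc i - j], ivar := (ivar s)(6 := i, 7 := j)\<rparr>) t'"
      if "t' \<le> t + 20" for t'
      using that by (simp add: min_def)
    then show ?thesis
      unfolding write_bar_def using assms(2,3) False \<open>ivar s 1 = q\<close>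
      by (auto intro!: loop simp flip: Suc_eq_plus1)
  qed
qed

lemma wp_write_trace:
  assumes "has_input s" "has_table (Suc p) q s" "ivar s 4 = i" "ivar s 5 = j"
    "1 \<le> i" "i \<le> Suc p" "2 \<le> j" "j \<le> Suc q"
    and "\<And>s' t'. out s' = out s @ [Suc i - j] @ flat (trace (i - 1) (j - 1)) \<Longrightarrow>
      t' \<le> t + 40 + 60 * p \<Longrightarrow> Q s' t'"
  shows "wp write_trace Q s t"
proof -
  \<comment> \<open>What has been written, followed by the trace still to come, stays constant. Both
    branches lower the row by one, so at most \<open>p\<close> rounds of cost at most 60
    occur.\<close>
  define I where "I s' t' \<longleftrightarrow> (\<exists>a b. a \<le> p \<and> 1 \<le> b \<and> b \<le> q \<and> has_input s' \<and>
    has_table (Suc p) q s' \<and> ivar s' 2 = a \<and> ivar s' 3 = b \<and>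
    out s' @ flat (trace a b) = out s @ [Suc i - j] @ flat (trace (i - 1) (j - 1)) \<and>
    t' + 60 * a \<le> t + 30 + 60 * p)" for s' t'
  have loop: "wp (While (ILess (IVar 3) (IAdd (IVar 2) (IConst 1))) trace_step) Q s1 t1"
    if "I s1 t1" for s1 t1
    using that
  proof (rule wp_While[where m = "\<lambda>s. ivar s 2"])
    fix s2 t2
    assume "I s2 t2" "tval (ILess (IVar 3) (IAdd (IVar 2) (IConst 1))) s2"
    then obtain a b where *: "a \<le> p" "1 \<le> b" "b \<le> q" "b \<le> a" "has_input s2"
      "has_table (Suc p) q s2" "ivar s2 2 = a" "ivar s2 3 = b"
      "out s2 @ flat (trace a b) = out s @ [Suc i - j] @ flat (trace (i - 1) (j - 1))"
      "t2 + 60 * a \<le> t + 30 + 60 * p"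
      by (auto simp: I_def)
    \<comment> \<open>The full table contains every value that the scan had available at
      \<open>(a, b)\<close>, so the analysis of the shared test applies again.\<close>
    have "has_table a b s2"
      using *(1,6) by (auto simp: has_table_def scanned_def)
    with * have at: "at_entry a b s2"
      by (simp add: at_entry_def)
    show "wp trace_step (\<lambda>s' t'. I s' t' \<and> ivar s' 2 < ivar s2 2) s2
      (t2 + tcost (ILess (IVar 3) (IAdd (IVar 2) (IConst 1))))"
      unfolding trace_step_def
    proof (rule wp_if_shift[OF at])
      fix u
      assume "u \<le> t2 + tcost (ILess (IVar 3) (IAdd (IVar 2) (IConst 1))) + 33" "1 < b" "min_shift (a - 1) (b - 1) < min_shift (a - 1) b + entry a b"
      moreover from this have "trace a b = trace (a - 1) (b - 1)"
        using * by (simp add: trace_unfold)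
      ultimately show "wp (Seq (ISet 2 (ISub (IVar 2) (IConst 1))) (ISet 3 (ISub (IVar 3) (IConst 1))))
        (\<lambda>s' t'. I s' t' \<and> ivar s' 2 < ivar s2 2) s2 u"
        using * by (auto simp: I_def has_input_def has_table_def)
    next
      fix u
      assume "u \<le> t2 + tcost (ILess (IVar 3) (IAdd (IVar 2) (IConst 1))) + 33"
        "\<not> (1 < b \<and> min_shift (a - 1) (b - 1) < min_shift (a - 1) b + entry a b)"
      moreover from this have "trace a b = (a, b) # trace (a - 1) b"
        using *(2,4) by (subst trace_unfold) auto
      ultimately show "wp (Seq (Write (IVar 2)) (Seq (Write (IVar 3)) (ISet 2 (ISub (IVar 2) (IConst 1)))))
        (\<lambda>s' t'. I s' t' \<and> ivar s' 2 < ivar s2 2) s2 u"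
        using * by (auto simp: I_def has_input_def has_table_def)
    qed
  next
    fix s2 t2
    assume I: "I s2 t2" "\<not> tval (ILess (IVar 3) (IAdd (IVar 2) (IConst 1))) s2"
    then have "out s2 = out s @ [Suc i - j] @ flat (trace (i - 1) (j - 1))" "t2 \<le> t + 30 + 60 * p"
      by (auto simp: I_def trace_above_diagonal)
    then show "Q s2 (t2 + tcost (ILess (IVar 3) (IAdd (IVar 2) (IConst 1))))"
      by (intro assms(9)) simp_all
  qed
  have "I (s\<lparr>out := out s @ [Suc i - j], ivar := (ivar s)(2 := i - 1, 3 := j - 1)\<rparr>) t'"
    if "t' \<le> t + 30" for t'
    unfolding I_def using assms(1,2,5-8) that
    by (intro exI[of _ "i - 1"] exI[of _ "j - 1"]) (auto simp: has_input_def has_table_def)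
  then show ?thesis
    unfolding write_trace_def using assms(3,4) by (auto intro!: loop simp flip: Suc_eq_plus1)
qed

lemma wp_separate:
  "wp separate (\<lambda>s t. t \<le> 1000 * (p * q) \<and> correct_answer p q x (out s)) (initial_state p q x) 0"
  unfolding separate_def wp_Seq
proof (rule wp_scan)
  fix s t
  assume s: "at_row (Suc p) s" and t: "t \<le> 10 + 210 * (p * q)"
  \<comment> \<open>These bounds absorb the linear terms, and \<open>4 \<le> p * q\<close> the
    constants, into a multiple of \<open>p * q\<close>.\<close>
  have "p \<le> p * q" "q \<le> p * q" "2 * 2 \<le> p * q"
    using q_ge_2 q_le_p mult_le_mono[of 2 p 2 q] by auto
  note size = this
  let ?Q = "\<lambda>s t. t \<le> 1000 * (p * q) \<and> correct_answer p q x (out s)"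
  show "wp (If (ILess (IConst 0) (IVar 4)) (Seq (Write (IConst 1)) (Seq write_bar write_trace))
    (Write (IConst 0))) ?Q s t"
  proof (cases "ivar s 4 = 0")
    case True
    \<comment> \<open>After the last row the scanned positions include every one at which
      \<open>violated\<close> can hold.\<close>
    then have "\<not> violated k l" for k l
      using s by (auto simp: at_row_def has_record_def violated_def scanned_def)
    then show ?thesis
      using True s t size correct_answer_if_not_violated by (simp add: at_row_def)
  next
    case False
    define i where "i = ivar s 4"
    define j where "j = ivar s 5"
    have v: "violated i j"
      using False s by (simp add: at_row_def has_record_def i_def j_def)
    then have ij: "1 \<le> i" "i \<le> p" "2 \<le> j" "j \<le> q" "j \<le> i"
      using violated_below_diagonal[OF v] by (auto simp: violated_def)
    have "wp write_bar (wp write_trace ?Q) (s\<lparr>out := [1]\<rparr>) (5 + t)"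
    proof (rule wp_write_bar)
      show "has_input (s\<lparr>out := [1]\<rparr>)"
        using s by (simp add: at_row_def has_input_def)
      fix s1 t1
      assume s1: "has_input s1" "rarr s1 = rarr (s\<lparr>out := [1]\<rparr>)" "ivar s1 4 = i" "ivar s1 5 = j"
        "out s1 = out (s\<lparr>out := [1]\<rparr>) @ [Suc (min i q) - j] @ flat (map (Pair i) [j..<Suc (min i q)])"
        "t1 \<le> 5 + t + 60 + 30 * q"
      have "has_table (Suc p) q s1"
        using s s1(2) by (simp add: at_row_def has_table_def)
      with s1(1) show "wp write_trace ?Q s1 t1"
      proof (rule wp_write_trace[OF _ _ s1(3,4)])
        fix s2 t2
        assume s2: "out s2 = out s1 @ [Suc i - j] @ flat (trace (i - 1) (j - 1))"
          "t2 \<le> t1 + 40 + 60 * p"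
        have "out s2 = [1, Suc (min i q) - j] @ flat (map (Pair i) [j..<Suc (min i q)]) @
          [i + 1 - j] @ flat (trace (i - 1) (j - 1))"
          using s2(1) s1(5) by (simp del: upt_Suc)
        moreover have "t2 \<le> 1000 * (p * q)"
          using s1(6) s2(2) t size by linarith
        ultimately show "t2 \<le> 1000 * (p * q) \<and> correct_answer p q x (out s2)"
          using correct_answer_if_violated[OF v] by (simp del: upt_Suc)
      qed (use ij in auto)
    qed (use ij in \<open>auto simp: i_def j_def\<close>)
    with False s show ?thesis
      by (simp add: at_row_def)
  qed
qed

end

theorem corollary11:
  "\<exists>(prog :: com) (K :: nat). \<forall>(p :: nat) (q :: nat). 2 \<le> q \<and> q \<le> p \<longrightarrow>
     (\<forall>x :: nat \<times> nat \<Rightarrow> rat. \<exists>t s.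
        exec prog (initial_state p q x) t s \<and> t \<le> K * (p * q) \<and> correct_answer p q x (out s))"
proof (rule exI[of _ separate], rule exI[of _ 1000], intro allI impI)
  fix p q :: nat and x :: "nat \<times> nat \<Rightarrow> rat"
  assume "2 \<le> q \<and> q \<le> p"
  then interpret separation p q x by unfold_locales auto
  show "\<exists>t s. exec separate (initial_state p q x) t s \<and> t \<le> 1000 * (p * q) \<and>
    correct_answer p q x (out s)"
    using wp_separate unfolding wp_def by simp
qed

end
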